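(* Let $Y$ be a non-empty subset of a topological vector space $E$ and let $K$ be an $(n-1)$-dimensional simplex in $E$. Let $T:K\to 2^{Y}$ be a weakly naturally quasi-concave correspondence and let $s:Y\to K$ be a continuous function. Then there exists $x^{*}\in K$ such that $x^{*}\in s\circ T(x^{*})$, i.e. $x^{*}=s(y)$ for some $y\in T(x^{*})$.
   Context: $2^{Y}$ denotes the family of all subsets of $Y$; a correspondence $T:X\to 2^{Y}$ is a set-valued map. An $(n-1)$-dimensional simplex is the convex hull of $n$ affinely independent points. Let $\Delta_{n-1}=\{(\lambda_1,\dots,\lambda_n)\in\mathbb{R}^n:\sum_{i=1}^n\lambda_i=1,\ \lambda_i\ge 0 \text{ for all } i\}$. Weakly naturally quasi-concave (WNQ): let $X$ be a non-empty convex subset of a topological vector space and $Y$ a non-empty subset of a topological vector space. A correspondence $T:X\to 2^{Y}$ is weakly naturally quasi-concave if for each $n$ and each finite set $\{x_1,\dots,x_n\}\subset X$ there exist $y_i\in T(x_i)$ ($i=1,\dots,n$) and continuous functions $g_i:[0,1]\to[0,1]$ with $g_i(0)=0$ and $g_i(1)=1$ ($i=1,\dots,n$) such that $(g_1(\lambda_1),\dots,g_n(\lambda_n))\in\Delta_{n-1}$ whenever $(\lambda_1,\dots,\lambda_n)\in\Delta_{n-1}$, and such that for every $(\lambda_1,\dots,\lambda_n)\in\Delta_{n-1}$ one has $\sum_{i=1}^n g_i(\lambda_i)y_i\in T\left(\sum_{i=1}^n\lambda_i x_i\right)$.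
   Formalization: The topological vector space E is assumed Hausdorff; otherwise the claim fails, e.g. E = R with the indiscrete topology, Y = K = [0,1], T(x) = {x} and s any fixed-point-free map of [0,1]. *)

theory Defs
  imports "HOL-Analysis.Analysis" "HOL-Homology.Simplices"
begin

(* Real topological vector spaces. Hausdorffness is not part of the class; where it is needed,
   the sort is {topological_real_vector, t2_space}. *)
class topological_real_vector = real_vector + topological_ab_group_add +
  assumes tendsto_scaleR_Pair: "LIM x (nhds a \<times>\<^sub>F nhds b). fst x *\<^sub>R snd x :> nhds (a *\<^sub>R b)"

instance real_normed_vector \<subseteq> topological_real_vector
proof
  fix a :: real and b :: 'a
  show "LIM x (nhds a \<times>\<^sub>F nhds b). fst x *\<^sub>R snd x :> nhds (a *\<^sub>R b)"
    unfolding nhds_prod[symmetric] using tendsto_fst[OF filterlim_ident] tendsto_snd[OF filterlim_ident]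
    by (intro tendsto_scaleR) (auto simp: filterlim_def)
qed

(* The library's infix simplex is available on euclidean_space only; this is the same
   notion on an arbitrary real vector space, see simplex_of_dim_iff_simplex. *)
definition simplex_of_dim :: "nat \<Rightarrow> 'a::real_vector set \<Rightarrow> bool" where
  "simplex_of_dim k K \<longleftrightarrow>
     (\<exists>C. finite C \<and> card C = k + 1 \<and> \<not> affine_dependent C \<and> K = convex hull C)"

lemma simplex_of_dim_iff_simplex:
  fixes K :: "'a::euclidean_space set"
  shows "simplex_of_dim k K \<longleftrightarrow> int k simplex K"
  unfolding simplex_of_dim_def simplex by auto

(* The n = p + 1 points are indexed by 0, ..., p, and standard_simplex p is the set of
   barycentric coordinates, whose elements are the sequences vanishing beyond index p; hence the
   zero padding of (g 0 (l 0), ..., g p (l p)). The points x i are pairwise distinct because a finite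
   set of n points is being enumerated. *)
definition weakly_naturally_quasiconcave ::
    "'a::topological_real_vector set \<Rightarrow> ('a \<Rightarrow> 'b::topological_real_vector set) \<Rightarrow> bool" where
  "weakly_naturally_quasiconcave X T \<longleftrightarrow>
     (\<forall>p (x :: nat \<Rightarrow> 'a). inj_on x {..p} \<and> x ` {..p} \<subseteq> X \<longrightarrow>
        (\<exists>(y :: nat \<Rightarrow> 'b) (g :: nat \<Rightarrow> real \<Rightarrow> real).
           (\<forall>i\<le>p. y i \<in> T (x i)) \<and>
           (\<forall>i\<le>p. continuous_on {0..1} (g i) \<and> g i ` {0..1} \<subseteq> {0..1} \<and> g i 0 = 0 \<and> g i 1 = 1) \<and>
           (\<forall>l\<in>standard_simplex p. (\<lambda>i. if i \<le> p then g i (l i) else 0) \<in> standard_simplex p) \<and>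
           (\<forall>l\<in>standard_simplex p.
              (\<Sum>i\<le>p. g i (l i) *\<^sub>R y i) \<in> T (\<Sum>i\<le>p. l i *\<^sub>R x i))))"

end

theory Submission
  imports Defs
begin

text \<open>
  Let \<open>x\<^sub>0, \<dots>, x\<^sub>p\<close> be the vertices of \<open>K\<close>. Quasi-concavity, applied once and to these
  vertices only, supplies a continuous selection of \<open>T\<close> along the barycentric
  parametrisation \<open>l \<mapsto> \<Sum> l\<^sub>i x\<^sub>i\<close> of \<open>K\<close>: the map \<open>l \<mapsto> \<Sum> g\<^sub>i(l\<^sub>i) y\<^sub>i\<close> takes its
  value in \<open>T (\<Sum> l\<^sub>i x\<^sub>i)\<close>. Following it by \<open>s\<close> gives a continuous map from the standard simplex
  to \<open>K\<close>, and the theorem asks where this map agrees with the parametrisation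
  (\<open>barycentric_coincidence\<close>). By affine independence the parametrisation is a continuous bijection
  from a compact space to a Hausdorff space, so barycentric coordinates are continuous on \<open>K\<close>, and the
  coincidence is a fixed point of a continuous self-map of the standard simplex.

  The dimension of the simplex is a number and not a type, so Brouwer's theorem is needed
  for sequences of reals. It follows from Kuhn's combinatorial lemma for the cube
  (\<open>brouwer_sequence_cube\<close>), and a retraction carries it over to the simplex
  (\<open>brouwer_standard_simplex\<close>).
\<close>

section \<open>Brouwer's theorem for sequences of reals\<close>

text \<open>Sequences padded with zeros, as in \<^const>\<open>standard_simplex\<close>: a simplex on \<open>p + 1\<close> vertices then
  lies in the cube with \<open>p + 1\<close> coordinates, whatever \<open>p\<close> is.\<close>

definition sequence_cube :: "nat \<Rightarrow> (nat \<Rightarrow> real) set" where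
  "sequence_cube n = {x. (\<forall>i<n. 0 \<le> x i \<and> x i \<le> 1) \<and> (\<forall>i\<ge>n. x i = 0)}"

lemma compact_sequence_cube: "compact (sequence_cube n)"
proof -
  let ?I = "\<lambda>i. if i < n then {0..1::real} else {0}"
  have "sequence_cube n = (\<Pi>\<^sub>E i\<in>UNIV. ?I i)"
  proof (rule Set.set_eqI)
    fix x :: "nat \<Rightarrow> real"
    have "x \<in> (\<Pi>\<^sub>E i\<in>UNIV. ?I i) \<longleftrightarrow> (\<forall>i. x i \<in> ?I i)"
      unfolding PiE_UNIV_domain Pi_iff by blast
    also have "\<dots> \<longleftrightarrow> x \<in> sequence_cube n"
      unfolding sequence_cube_def mem_Collect_eq
      by (metis atLeastAtMost_iff not_less singleton_iff)
    finally show "x \<in> sequence_cube n \<longleftrightarrow> x \<in> (\<Pi>\<^sub>E i\<in>UNIV. ?I i)"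
      by (rule sym)
  qed
  moreover have "compactin (powertop_real UNIV) (\<Pi>\<^sub>E i\<in>UNIV. ?I i)"
    unfolding compactin_PiE by simp
  ultimately show ?thesis
    by (simp only: euclidean_product_topology compactin_euclidean_iff)
qed

lemma compact_standard_simplex: "compact (standard_simplex p)"
  using compactin_standard_simplex[of p]
  by (simp only: euclidean_product_topology compactin_euclidean_iff)

lemma tendsto_coordinatewise:
  fixes X :: "'a \<Rightarrow> 'i \<Rightarrow> 'b::topological_space"
  shows "(X \<longlongrightarrow> l) F \<longleftrightarrow> (\<forall>i. ((\<lambda>m. X m i) \<longlongrightarrow> l i) F)"
proof -
  have "limitin (product_topology (\<lambda>i. euclidean) UNIV) X l F \<longleftrightarrow> (\<forall>i. ((\<lambda>m. X m i) \<longlongrightarrow> l i) F)"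
    by (simp add: limitin_componentwise)
  then show ?thesis
    unfolding euclidean_product_topology by simp
qed

text \<open>Kuhn's lemma on the grid of mesh \<open>1/q\<close>. A grid point is labelled \<open>0\<close> in coordinate \<open>i\<close> only if \<open>f\<close> does
  not decrease that coordinate, and \<open>1\<close> only if \<open>f\<close> does not increase it; some cell
  carries both labels in every coordinate.\<close>

lemma sequence_cube_cell_with_both_labels:
  assumes self: "f ` sequence_cube n \<subseteq> sequence_cube n" and q: "0 < q"
  shows "\<exists>z a b. z \<in> sequence_cube n \<and>
    (\<forall>i<n. a i \<in> sequence_cube n \<and> b i \<in> sequence_cube n \<and>
       a i i \<le> f (a i) i \<and> f (b i) i \<le> b i i \<and>
       (\<forall>j. \<bar>a i j - z j\<bar> \<le> 1 / real q \<and> \<bar>b i j - z j\<bar> \<le> 1 / real q))"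
proof -
  define pt :: "(nat \<Rightarrow> nat) \<Rightarrow> nat \<Rightarrow> real"
    where "pt x = (\<lambda>j. if j < n then real (x j) / real q else 0)" for x
  \<comment> \<open>On the face \<open>x i = q\<close> the label must be \<open>1\<close>, even at a point where \<open>f\<close> fixes coordinate \<open>i\<close>.\<close>
  define label :: "(nat \<Rightarrow> nat) \<Rightarrow> nat \<Rightarrow> nat"
    where "label x i = (if x i \<noteq> q \<and> pt x i \<le> f (pt x) i then 0 else 1)" for x i
  have pt: "pt x \<in> sequence_cube n" if "\<forall>i<n. x i \<le> q" for x
    using that q by (auto simp: pt_def sequence_cube_def)
  have fpt: "0 \<le> f (pt x) i \<and> f (pt x) i \<le> 1" if "\<forall>i<n. x i \<le> q" "i < n" for x i
  proof -
    have "f (pt x) \<in> sequence_cube n"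
      using self pt[OF that(1)] by blast
    then show ?thesis
      using that(2) by (simp add: sequence_cube_def)
  qed
  have up: "pt x i \<le> f (pt x) i" if "label x i = 0" for x i
    using that by (auto simp: label_def split: if_splits)
  have down: "f (pt x) i \<le> pt x i" if "label x i \<noteq> 0" "\<forall>i<n. x i \<le> q" "i < n" for x i
    using that fpt[OF that(2,3)] q by (auto simp: label_def pt_def split: if_splits)
  have "\<forall>x. (\<forall>i<n. x i \<le> q) \<longrightarrow> (\<forall>i<n. label x i = 0 \<or> label x i = 1)"
    by (simp add: label_def)
  moreover have "\<forall>x. (\<forall>i<n. x i \<le> q) \<longrightarrow> (\<forall>i<n. x i = 0 \<longrightarrow> label x i = 0)"
  proof (intro allI impI)
    fix x i assume x: "\<forall>i<n. x i \<le> q" "i < n" "x i = 0"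
    then have "pt x i = 0"
      by (simp add: pt_def)
    then show "label x i = 0"
      using fpt[OF x(1,2)] x(3) q by (simp add: label_def)
  qed
  moreover have "\<forall>x. (\<forall>i<n. x i \<le> q) \<longrightarrow> (\<forall>i<n. x i = q \<longrightarrow> label x i = 1)"
    by (simp add: label_def)
  ultimately obtain c where c: "\<forall>i<n. c i < q"
    and cell: "\<forall>i<n. \<exists>r s. (\<forall>j<n. c j \<le> r j \<and> r j \<le> c j + 1) \<and>
                 (\<forall>j<n. c j \<le> s j \<and> s j \<le> c j + 1) \<and> label r i \<noteq> label s i"
    by (rule kuhn_lemma[OF q])
  have near: "\<bar>pt r j - pt c j\<bar> \<le> 1 / real q" if "\<forall>j<n. c j \<le> r j \<and> r j \<le> c j + 1" for r j
  proof (cases "j < n")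
    case True
    then have "\<bar>real (r j) - real (c j)\<bar> \<le> 1"
      using that[rule_format, OF True] by linarith
    then show ?thesis
      using True q by (simp add: pt_def divide_right_mono flip: diff_divide_distrib)
  qed (simp add: pt_def)
  have "\<exists>a b. a \<in> sequence_cube n \<and> b \<in> sequence_cube n \<and> a i \<le> f a i \<and> f b i \<le> b i \<and>
          (\<forall>j. \<bar>a j - pt c j\<bar> \<le> 1 / real q \<and> \<bar>b j - pt c j\<bar> \<le> 1 / real q)" if i: "i < n" for i
  proof -
    from cell i obtain r s where r: "\<forall>j<n. c j \<le> r j \<and> r j \<le> c j + 1"
      and s: "\<forall>j<n. c j \<le> s j \<and> s j \<le> c j + 1" and rs: "label r i \<noteq> label s i"
      by blast
    have rq: "\<forall>j<n. r j \<le> q" and sq: "\<forall>j<n. s j \<le> q"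
      using r s c by (metis Suc_eq_plus1 Suc_leI order_trans)+
    show ?thesis
    proof (cases "label r i = 0")
      case True
      then show ?thesis
        using rs up[of r i] down[of s i] rq sq i pt near[OF r] near[OF s]
        by (intro exI[of _ "pt r"] exI[of _ "pt s"]) auto
    next
      case False
      then have "label s i = 0"
        using rs by (simp add: label_def split: if_splits)
      with False show ?thesis
        using up[of s i] down[of r i] rq sq i pt near[OF r] near[OF s]
        by (intro exI[of _ "pt s"] exI[of _ "pt r"]) auto
    qed
  qed
  then obtain a b where "\<forall>i<n. a i \<in> sequence_cube n \<and> b i \<in> sequence_cube n \<and>
       a i i \<le> f (a i) i \<and> f (b i) i \<le> b i i \<and>
       (\<forall>j. \<bar>a i j - pt c j\<bar> \<le> 1 / real q \<and> \<bar>b i j - pt c j\<bar> \<le> 1 / real q)"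
    by metis
  moreover have "pt c \<in> sequence_cube n"
    using c pt by (simp add: less_imp_le)
  ultimately show ?thesis
    by blast
qed

text \<open>As the mesh shrinks, the doubly labelled cells accumulate at a point. There continuity turns the
  two families of inequalities into equality, one coordinate at a time.\<close>

theorem brouwer_sequence_cube:
  assumes cont: "continuous_on (sequence_cube n) f"
    and self: "f ` sequence_cube n \<subseteq> sequence_cube n"
  shows "\<exists>x\<in>sequence_cube n. f x = x"
proof -
  let ?C = "sequence_cube n"
  have "\<forall>m. \<exists>z a b. z \<in> ?C \<and>
    (\<forall>i<n. a i \<in> ?C \<and> b i \<in> ?C \<and> a i i \<le> f (a i) i \<and> f (b i) i \<le> b i i \<and>
       (\<forall>j. \<bar>a i j - z j\<bar> \<le> 1 / real (Suc m) \<and> \<bar>b i j - z j\<bar> \<le> 1 / real (Suc m)))"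
    by (intro allI sequence_cube_cell_with_both_labels[OF self zero_less_Suc])
  then obtain z a b where cells: "\<forall>m. z m \<in> ?C \<and>
    (\<forall>i<n. a m i \<in> ?C \<and> b m i \<in> ?C \<and> a m i i \<le> f (a m i) i \<and> f (b m i) i \<le> b m i i \<and>
       (\<forall>j. \<bar>a m i j - z m j\<bar> \<le> 1 / real (Suc m) \<and> \<bar>b m i j - z m j\<bar> \<le> 1 / real (Suc m)))"
    unfolding choice_iff by blast
  have z: "\<And>m. z m \<in> ?C"
    and ab: "\<And>m i. i < n \<Longrightarrow> a m i \<in> ?C \<and> b m i \<in> ?C \<and>
       a m i i \<le> f (a m i) i \<and> f (b m i) i \<le> b m i i"
    and near: "\<And>m i j. i < n \<Longrightarrow> \<bar>a m i j - z m j\<bar> \<le> 1 / real (Suc m) \<and>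
       \<bar>b m i j - z m j\<bar> \<le> 1 / real (Suc m)"
    using cells by blast+
  have "seq_compact ?C"
    by (intro compact_imp_seq_compact compact_sequence_cube)
  with z obtain l r where l: "l \<in> ?C" and r: "strict_mono r" and lim: "(z \<circ> r) \<longlonglongrightarrow> l"
    unfolding seq_compact_def by metis
  have vanish: "(\<lambda>m. 1 / real (Suc (r m))) \<longlonglongrightarrow> 0"
    using LIMSEQ_subseq_LIMSEQ[OF LIMSEQ_Suc[OF lim_1_over_n] r]
    by (simp add: o_def)
  have shadow: "(\<lambda>m. w (r m)) \<longlonglongrightarrow> l"
    if "\<And>m j. \<bar>w m j - z m j\<bar> \<le> 1 / real (Suc m)" for w :: "nat \<Rightarrow> nat \<Rightarrow> real"
    unfolding tendsto_coordinatewise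
  proof
    fix j
    have "(\<lambda>m. w (r m) j - z (r m) j) \<longlonglongrightarrow> 0"
    proof (rule Lim_null_comparison[OF _ vanish], intro always_eventually allI)
      show "norm (w (r m) j - z (r m) j) \<le> 1 / real (Suc (r m))" for m
        using that[where m = "r m" and j = j] by simp
    qed
    moreover have "(\<lambda>m. z (r m) j) \<longlonglongrightarrow> l j"
      using lim by (simp add: tendsto_coordinatewise o_def)
    ultimately show "(\<lambda>m. w (r m) j) \<longlonglongrightarrow> l j"
      using tendsto_add by fastforce
  qed
  have limf: "(\<lambda>m. f (w (r m)) i) \<longlonglongrightarrow> f l i"
    if "(\<lambda>m. w (r m)) \<longlonglongrightarrow> l" "\<And>m. w m \<in> ?C" for w :: "nat \<Rightarrow> nat \<Rightarrow> real" and i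
    using continuous_on_tendsto_compose[OF cont that(1) l] that(2)
    by (simp add: tendsto_coordinatewise)
  have "f l i = l i" for i
  proof (cases "i < n")
    case True
    have a: "(\<lambda>m. a (r m) i) \<longlonglongrightarrow> l" and b: "(\<lambda>m. b (r m) i) \<longlonglongrightarrow> l"
      using shadow[of "\<lambda>m. a m i"] shadow[of "\<lambda>m. b m i"] near[OF True] by auto
    have "l i \<le> f l i"
      using a limf[of "\<lambda>m. a m i", OF a] ab[OF True]
      by (intro LIMSEQ_le[of "\<lambda>m. a (r m) i i" _ "\<lambda>m. f (a (r m) i) i"])
        (auto simp: tendsto_coordinatewise)
    moreover have "f l i \<le> l i"
      using b limf[of "\<lambda>m. b m i", OF b] ab[OF True]
      by (intro LIMSEQ_le[of "\<lambda>m. f (b (r m) i) i" _ "\<lambda>m. b (r m) i i"])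
        (auto simp: tendsto_coordinatewise)
    ultimately show ?thesis
      by simp
  next
    case False
    moreover have "f l \<in> ?C"
      using self l by blast
    ultimately show ?thesis
      using l by (simp add: sequence_cube_def)
  qed
  with l show ?thesis
    by blast
qed

text \<open>Normalising a point of the cube by its coordinate sum fails at the origin. A sum below \<open>1\<close> is
  therefore first brought up to \<open>1\<close> through coordinate \<open>0\<close>, and only a sum above \<open>1\<close> is divided out.\<close>

definition simplex_retraction :: "nat \<Rightarrow> (nat \<Rightarrow> real) \<Rightarrow> nat \<Rightarrow> real" where
  "simplex_retraction p x i =
     (x i + (if i = 0 then max 0 (1 - (\<Sum>j\<le>p. x j)) else 0)) / max 1 (\<Sum>j\<le>p. x j)"

lemma continuous_on_coordinate_sum:
  "continuous_on S (\<lambda>x :: nat \<Rightarrow> real. \<Sum>j\<le>p. x j)"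
  by (intro continuous_on_sum continuous_on_subset[OF continuous_on_product_coordinates]) simp

lemma continuous_on_simplex_retraction: "continuous_on S (simplex_retraction p)"
proof (rule continuous_on_coordinatewise_then_product)
  fix i
  have "continuous_on S (\<lambda>x :: nat \<Rightarrow> real. x i)"
    by (rule continuous_on_subset[OF continuous_on_product_coordinates]) simp
  moreover have "continuous_on S (\<lambda>x. if i = 0 then max 0 (1 - (\<Sum>j\<le>p. x j)) else 0 :: real)"
    by (cases "i = 0")
      (simp_all add: continuous_on_max continuous_on_diff continuous_on_const continuous_on_coordinate_sum)
  moreover have "max 1 (\<Sum>j\<le>p. x j) \<noteq> 0" for x :: "nat \<Rightarrow> real"
    by linarith
  ultimately show "continuous_on S (\<lambda>x. simplex_retraction p x i)"
    unfolding simplex_retraction_def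
    by (intro continuous_on_divide continuous_on_add continuous_on_max continuous_on_const
        continuous_on_coordinate_sum) blast+
qed

lemma simplex_retraction_in_simplex:
  assumes "x \<in> sequence_cube (Suc p)"
  shows "simplex_retraction p x \<in> standard_simplex p"
proof -
  let ?S = "\<Sum>j\<le>p. x j"
  have nonneg: "0 \<le> x i" for i
    using assms by (cases "i < Suc p") (auto simp: sequence_cube_def)
  have pos: "0 < max 1 ?S"
    by linarith
  have ge: "0 \<le> simplex_retraction p x i" for i
    using nonneg pos by (simp add: simplex_retraction_def)
  have one: "(\<Sum>i\<le>p. simplex_retraction p x i) = 1"
  proof -
    have "(\<Sum>i\<le>p. simplex_retraction p x i) = (?S + max 0 (1 - ?S)) / max 1 ?S"
      by (simp add: simplex_retraction_def sum.distrib flip: sum_divide_distrib)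
    also have "?S + max 0 (1 - ?S) = max 1 ?S"
      by linarith
    finally show ?thesis
      using pos by simp
  qed
  have zero: "simplex_retraction p x i = 0" if "i > p" for i
    using that assms by (simp add: simplex_retraction_def sequence_cube_def)
  have "simplex_retraction p x i \<le> 1" for i
  proof (cases "i \<le> p")
    case True
    then show ?thesis
      using member_le_sum[of i "{..p}" "simplex_retraction p x"] ge one by simp
  qed (simp add: zero)
  with ge one zero show ?thesis
    by (simp add: standard_simplex_def)
qed

lemma simplex_retraction_fixes_simplex:
  "x \<in> standard_simplex p \<Longrightarrow> simplex_retraction p x = x"
  by (simp add: standard_simplex_def simplex_retraction_def fun_eq_iff)

lemma standard_simplex_subset_cube: "standard_simplex p \<subseteq> sequence_cube (Suc p)"
  by (auto simp: standard_simplex_def sequence_cube_def Suc_le_eq)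

theorem brouwer_standard_simplex:
  assumes cont: "continuous_on (standard_simplex p) f"
    and self: "f ` standard_simplex p \<subseteq> standard_simplex p"
  shows "\<exists>l\<in>standard_simplex p. f l = l"
proof -
  let ?g = "f \<circ> simplex_retraction p"
  have into: "simplex_retraction p ` sequence_cube (Suc p) \<subseteq> standard_simplex p"
    using simplex_retraction_in_simplex by blast
  have "continuous_on (sequence_cube (Suc p)) ?g"
    by (intro continuous_on_compose continuous_on_simplex_retraction
        continuous_on_subset[OF cont into])
  moreover have img: "?g ` sequence_cube (Suc p) \<subseteq> standard_simplex p"
    using into self by (auto simp: image_subset_iff)
  ultimately obtain x where x: "x \<in> sequence_cube (Suc p)" "?g x = x"
    using brouwer_sequence_cube[of "Suc p" ?g] standard_simplex_subset_cube by blast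
  \<comment> \<open>The fixed point is a value of \<open>f\<close>, hence lies in the simplex, where the retraction is the identity.\<close>
  then have "x \<in> standard_simplex p"
    using img by (metis image_subset_iff)
  with x show ?thesis
    by (metis comp_apply simplex_retraction_fixes_simplex)
qed

section \<open>Barycentric coordinates in a Hausdorff topological vector space\<close>

lemma continuous_on_scaleR_topological_real_vector:
  fixes v :: "'b::topological_space \<Rightarrow> 'a::topological_real_vector"
  assumes "continuous_on S c" "continuous_on S v"
  shows "continuous_on S (\<lambda>x. c x *\<^sub>R v x)"
  unfolding continuous_on_def
proof
  fix x assume "x \<in> S"
  then have "((\<lambda>y. (c y, v y)) \<longlongrightarrow> (c x, v x)) (at x within S)"
    using assms by (intro tendsto_Pair) (auto simp: continuous_on_def)
  then have "filterlim (\<lambda>y. (c y, v y)) (nhds (c x) \<times>\<^sub>F nhds (v x)) (at x within S)"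
    by (simp add: nhds_prod)
  from filterlim_compose[OF tendsto_scaleR_Pair this]
  show "((\<lambda>y. c y *\<^sub>R v y) \<longlongrightarrow> c x *\<^sub>R v x) (at x within S)"
    by simp
qed

lemma continuous_on_coordinate_combination:
  fixes y :: "nat \<Rightarrow> 'a::topological_real_vector"
  assumes "\<And>i. i \<le> p \<Longrightarrow> continuous_on {0..1} (g i)"
  shows "continuous_on (standard_simplex p) (\<lambda>l. \<Sum>i\<le>p. g i (l i) *\<^sub>R y i)"
proof (intro continuous_on_sum continuous_on_scaleR_topological_real_vector continuous_on_const)
  fix i assume "i \<in> {..p}"
  then show "continuous_on (standard_simplex p) (\<lambda>l. g i (l i))"
    using assms
    by (intro continuous_on_compose2[of "{0..1}" "g i" _ "\<lambda>l. l i"]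
        continuous_on_subset[OF continuous_on_product_coordinates])
      (auto simp: standard_simplex_def)
qed

lemma barycentric_map_inj_on:
  fixes x :: "nat \<Rightarrow> 'a::real_vector"
  assumes inj: "inj_on x {..p}" and indep: "\<not> affine_dependent (x ` {..p})"
  shows "inj_on (\<lambda>l. \<Sum>i\<le>p. l i *\<^sub>R x i) (standard_simplex p)"
proof (rule inj_onI)
  fix k l assume kl: "k \<in> standard_simplex p" "l \<in> standard_simplex p"
    and eq: "(\<Sum>i\<le>p. k i *\<^sub>R x i) = (\<Sum>i\<le>p. l i *\<^sub>R x i)"
  define U where "U v = k (the_inv_into {..p} x v) - l (the_inv_into {..p} x v)" for v
  have U: "U (x i) = k i - l i" if "i \<le> p" for i
    using that by (simp add: U_def the_inv_into_f_f[OF inj])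
  have "sum U (x ` {..p}) = (\<Sum>i\<le>p. k i - l i)"
    using inj U by (simp add: sum.reindex)
  also have "\<dots> = 0"
    using kl by (simp add: sum_subtractf standard_simplex_def)
  finally have "sum U (x ` {..p}) = 0" .
  moreover have "(\<Sum>v\<in>x ` {..p}. U v *\<^sub>R v) = (\<Sum>i\<le>p. (k i - l i) *\<^sub>R x i)"
    using inj U by (simp add: sum.reindex)
  moreover have "\<dots> = 0"
    using eq by (simp add: scaleR_left_diff_distrib sum_subtractf)
  ultimately have "\<forall>v\<in>x ` {..p}. U v = 0"
    using indep affine_dependent_explicit_finite[of "x ` {..p}"] by auto
  then have "k i = l i" for i
    using U kl by (cases "i \<le> p") (auto simp: standard_simplex_def)
  then show "k = l"
    by blast
qed

lemma barycentric_map_image: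
  fixes x :: "nat \<Rightarrow> 'a::real_vector"
  assumes inj: "inj_on x {..p}"
  shows "(\<lambda>l. \<Sum>i\<le>p. l i *\<^sub>R x i) ` standard_simplex p = convex hull (x ` {..p})"
proof (intro subset_antisym subsetI)
  fix z assume "z \<in> (\<lambda>l. \<Sum>i\<le>p. l i *\<^sub>R x i) ` standard_simplex p"
  then obtain l where l: "l \<in> standard_simplex p" and z: "z = (\<Sum>i\<le>p. l i *\<^sub>R x i)"
    by blast
  show "z \<in> convex hull (x ` {..p})"
    unfolding z using l
    by (intro convex_sum convex_convex_hull) (auto simp: standard_simplex_def hull_inc)
next
  fix z assume "z \<in> convex hull (x ` {..p})"
  then obtain u where u: "\<forall>v\<in>x ` {..p}. 0 \<le> u v" "sum u (x ` {..p}) = 1"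
    and z: "(\<Sum>v\<in>x ` {..p}. u v *\<^sub>R v) = z"
    by (auto simp: convex_hull_finite)
  let ?l = "\<lambda>i. if i \<le> p then u (x i) else 0"
  have sum1: "(\<Sum>i\<le>p. u (x i)) = 1"
    using u(2) inj by (simp add: sum.reindex)
  moreover have "u (x i) \<le> 1" if "i \<le> p" for i
    using member_le_sum[of i "{..p}" "\<lambda>i. u (x i)"] u(1) that sum1 by auto
  ultimately have mem: "?l \<in> standard_simplex p"
    using u(1) by (auto simp: standard_simplex_def)
  have comb: "z = (\<Sum>i\<le>p. ?l i *\<^sub>R x i)"
    using z inj by (simp add: sum.reindex)
  show "z \<in> (\<lambda>l. \<Sum>i\<le>p. l i *\<^sub>R x i) ` standard_simplex p"
    by (rule image_eqI[where x = ?l]) (rule comb, rule mem)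
qed

text \<open>Compactness of the standard simplex and the Hausdorff property make the inverse of the
  parametrisation continuous, so that \<open>h\<close> can be read in barycentric coordinates and handed to
  Brouwer's theorem.\<close>

lemma barycentric_coincidence:
  fixes x :: "nat \<Rightarrow> 'a::{topological_real_vector, t2_space}"
  assumes inj: "inj_on x {..p}" and indep: "\<not> affine_dependent (x ` {..p})"
    and cont: "continuous_on (standard_simplex p) h"
    and img: "h ` standard_simplex p \<subseteq> convex hull (x ` {..p})"
  shows "\<exists>l\<in>standard_simplex p. h l = (\<Sum>i\<le>p. l i *\<^sub>R x i)"
proof -
  define b where "b l = (\<Sum>i\<le>p. l i *\<^sub>R x i)" for l
  define c where "c = the_inv_into (standard_simplex p) b"
  have inj_b: "inj_on b (standard_simplex p)"
    using barycentric_map_inj_on[OF inj indep] by (simp add: b_def[abs_def])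
  have image_b: "b ` standard_simplex p = convex hull (x ` {..p})"
    using barycentric_map_image[OF inj] by (simp add: b_def[abs_def])
  have "continuous_on (standard_simplex p) b"
    using continuous_on_coordinate_combination[of p "\<lambda>i t. t" x]
    by (simp add: b_def[abs_def] continuous_on_id)
  then have "continuous_on (convex hull (x ` {..p})) c"
    unfolding c_def image_b[symmetric]
    by (rule continuous_on_inv_into[OF _ compact_standard_simplex inj_b])
  then have "continuous_on (standard_simplex p) (c \<circ> h)"
    by (intro continuous_on_compose cont continuous_on_subset[OF _ img])
  moreover have coords: "c z \<in> standard_simplex p \<and> b (c z) = z" if "z \<in> convex hull (x ` {..p})" for z
    using that inj_b unfolding c_def image_b[symmetric]
    by (auto simp: the_inv_into_f_f)
  ultimately obtain l where l: "l \<in> standard_simplex p" "c (h l) = l"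
    using brouwer_standard_simplex[of p "c \<circ> h"] img by (auto simp: image_subset_iff)
  then have "b l = h l"
    using coords[of "h l"] img by (simp add: image_subset_iff)
  with l(1) show ?thesis
    by (auto simp: b_def intro: sym)
qed

section \<open>The fixed point theorem\<close>

theorem theorem7:
  fixes Y K :: "'a::{topological_real_vector, t2_space} set"
    and T :: "'a \<Rightarrow> 'a set"
    and s :: "'a \<Rightarrow> 'a"
    and n :: nat
  assumes "Y \<noteq> {}"
    and "n \<ge> 1"
    and "simplex_of_dim (n - 1) K"
    and "\<forall>x\<in>K. T x \<subseteq> Y"
    and "weakly_naturally_quasiconcave K T"
    and "continuous_on Y s"
    and "s ` Y \<subseteq> K"
  shows "\<exists>x\<in>K. x \<in> s ` T x"
proof -
  define p where "p = n - 1"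
  obtain C where C: "finite C" "card C = Suc p" "\<not> affine_dependent C" and K: "K = convex hull C"
    using assms(3) by (auto simp: simplex_of_dim_def p_def)
  obtain x where "bij_betw x {..p} C"
    using ex_bij_betw_nat_finite[OF C(1)] C(2) by (auto simp: atLeast0LessThan lessThan_Suc_atMost)
  then have inj: "inj_on x {..p}" and x: "x ` {..p} = C"
    by (auto simp: bij_betw_def)
  have "x ` {..p} \<subseteq> K"
    unfolding x K by (rule hull_subset)
  with assms(5) inj obtain y g
    where g: "\<And>i. i \<le> p \<Longrightarrow> continuous_on {0..1} (g i)"
      and sel: "\<And>l. l \<in> standard_simplex p \<Longrightarrow>
        (\<Sum>i\<le>p. g i (l i) *\<^sub>R y i) \<in> T (\<Sum>i\<le>p. l i *\<^sub>R x i)"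
    unfolding weakly_naturally_quasiconcave_def by metis
  let ?f = "\<lambda>l. \<Sum>i\<le>p. g i (l i) *\<^sub>R y i"
  have inK: "(\<Sum>i\<le>p. l i *\<^sub>R x i) \<in> K" if "l \<in> standard_simplex p" for l
    using barycentric_map_image[OF inj] that by (auto simp: x K)
  then have fY: "?f ` standard_simplex p \<subseteq> Y"
    using sel assms(4) by blast
  have "continuous_on (standard_simplex p) (s \<circ> ?f)"
    using g by (intro continuous_on_compose continuous_on_coordinate_combination
        continuous_on_subset[OF assms(6) fY])
  moreover have "(s \<circ> ?f) ` standard_simplex p \<subseteq> convex hull (x ` {..p})"
    using fY assms(7) by (auto simp: x K)
  ultimately obtain l where l: "l \<in> standard_simplex p" "s (?f l) = (\<Sum>i\<le>p. l i *\<^sub>R x i)"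
    using barycentric_coincidence[OF inj, of "s \<circ> ?f"] C(3) by (auto simp: x)
  have "s (?f l) \<in> s ` T (\<Sum>i\<le>p. l i *\<^sub>R x i)"
    by (intro imageI sel l(1))
  then show ?thesis
    unfolding l(2) using inK[OF l(1)] by blast
qed

end
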